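(* For every formula $A$: if $\mathsf{H_C}\vdash A$ then $\mathsf{D_C}\vdash^{<\omega^2}_{\omega^2}A$.
   Context: Fix $h\ge1$ agents. Formulas: $A::=p\mid\bar p\mid A\vee A\mid A\wedge A\mid\Diamond_iA\mid\Box_iA\mid\widetilde{\mathsf C}A\mid\mathsf CA$ ($1\le i\le h$), $\widetilde{\mathsf C}$ the De Morgan dual of $\mathsf C$ (common knowledge); $\bar A$ by De Morgan laws, $A\supset B:=\bar A\vee B$. $\Box A:=\Box_1A\wedge\dots\wedge\Box_hA$, $\Diamond A:=\Diamond_1A\vee\dots\vee\Diamond_hA$, $\Box^k,\Diamond^k$ iterations. Rank: $rk(p)=rk(\bar p)=0$, $rk(A\wedge B)=rk(A\vee B)=\max(rk A,rk B)+1$, $rk(\Box_iA)=rk(\Diamond_iA)=rk(A)+1$, $rk(\mathsf CA)=rk(\widetilde{\mathsf C}A)=\omega+rk(A)$. $\mathsf{H_C}$ is some Hilbert system for classical propositional logic extended by the axioms $\Box_iA\wedge\Box_i(A\supset B)\supset\Box_iB$ and $\mathsf CA\supset(\Box A\wedge\Box\mathsf CA)$ and the rules: from $B\supset(\Box A\wedge\Box B)$ infer $B\supset\mathsf CA$; from $A$ and $A\supset B$ infer $B$; from $A$ infer $\Box_iA$. Nested sequents: finite multisets of formulas and boxed sequents $[\Delta]_i$; contexts $\Gamma\{\ \}$ as usual. System $\mathsf{D_C}$ (premises / conclusion): axiom $\Gamma\{p,\bar p\}$; $\wedge$: $\Gamma\{A\},\Gamma\{B\}/\Gamma\{A\wedge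 B\}$; $\vee$: $\Gamma\{A,B\}/\Gamma\{A\vee B\}$; $\Box_i$: $\Gamma\{[A]_i\}/\Gamma\{\Box_iA\}$; $\Diamond_i$: $\Gamma\{\Diamond_iA,[\Delta,A]_i\}/\Gamma\{\Diamond_iA,[\Delta]_i\}$; $\mathsf C$: premises $\Gamma\{\Box^kA\}$, all $k\ge1$ / $\Gamma\{\mathsf CA\}$; $\widetilde{\mathsf C}$: $\Gamma\{\widetilde{\mathsf C}A,\Diamond^kA\}/\Gamma\{\widetilde{\mathsf C}A\}$ (some $k\ge1$); cut: $\Gamma\{A\},\Gamma\{\bar A\}/\Gamma\{\emptyset\}$ of rank $rk(A)$. Proofs: well-founded possibly infinitely branching trees with axiom leaves; depth = least ordinal greater than depths of immediate subproofs. $\mathsf{D_C}\vdash^{\alpha}_\gamma\Gamma$: proof in $\mathsf{D_C}$ plus cuts of rank $<\gamma$ of depth $\le\alpha$; $\mathsf{D_C}\vdash^{<\alpha}_\gamma\Gamma$ means $\mathsf{D_C}\vdash^{\alpha_0}_\gamma\Gamma$ for some $\alpha_0<\alpha$. *)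

theory Defs
  imports "HOL-Library.Multiset" "HOL-Library.Product_Lexorder" "HOL-Library.Countable_Set_Type"
begin

section \<open>Ordinals\<close>

text \<open>
  Ordinals below \<open>\<omega>\<^sup>3\<close> in Cantor normal form: \<open>(a, b, c)\<close> stands for
  \<open>\<omega>\<^sup>2 \<cdot> a + \<omega> \<cdot> b + c\<close>, and the order is the lexicographic one of Product_Lexorder
  (an instance of class wellorder). This covers all ranks of formulas and the bound \<open>\<omega>\<^sup>2\<close>.
\<close>

type_synonym ord = "nat \<times> nat \<times> nat"

definition omega :: ord where
  "omega = (0, 1, 0)"

definition omega_sq :: ord where
  "omega_sq = (1, 0, 0)"

fun osucc :: "ord \<Rightarrow> ord" where
  "osucc (a, b, c) = (a, b, Suc c)"

text \<open>Ordinal addition (not commutative); see lemma \<open>oplus_rec\<close>.\<close>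

fun oplus :: "ord \<Rightarrow> ord \<Rightarrow> ord"  (infixl "\<oplus>" 65) where
  "(a, b, c) \<oplus> (a', b', c') =
     (if a' > 0 then (a + a', b', c')
      else if b' > 0 then (a, b + b', c')
      else (a, b, c + c'))"

lemma osucc_least: "osucc \<alpha> = (LEAST \<beta>. \<alpha> < \<beta>)"
  by (rule Least_equality[symmetric]; cases \<alpha>) (auto simp: less_prod_def less_eq_prod_def)

lemma oplus_rec: "\<alpha> \<oplus> \<beta> = (LEAST \<gamma>. \<alpha> \<le> \<gamma> \<and> (\<forall>\<delta><\<beta>. \<alpha> \<oplus> \<delta> < \<gamma>))"
proof (rule Least_equality[symmetric])
  show "\<alpha> \<le> \<alpha> \<oplus> \<beta> \<and> (\<forall>\<delta><\<beta>. \<alpha> \<oplus> \<delta> < \<alpha> \<oplus> \<beta>)"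
    by (cases \<alpha>; cases \<beta>) auto
next
  fix \<gamma> assume *: "\<alpha> \<le> \<gamma> \<and> (\<forall>\<delta><\<beta>. \<alpha> \<oplus> \<delta> < \<gamma>)"
  obtain a b c where \<alpha>: "\<alpha> = (a, b, c)" by (cases \<alpha>)
  obtain a' b' c' where \<beta>: "\<beta> = (a', b', c')" by (cases \<beta>)
  obtain x y z where \<gamma>: "\<gamma> = (x, y, z)" by (cases \<gamma>)
  have step: "\<alpha> \<oplus> \<delta> < \<gamma>" if "\<delta> < \<beta>" for \<delta>
    using * that by blast
  consider "c' > 0" | "c' = 0" "b' > 0" | "c' = 0" "b' = 0" "a' > 0" | "\<beta> = (0, 0, 0)"
    using \<beta> by auto
  then show "\<alpha> \<oplus> \<beta> \<le> \<gamma>"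
  proof cases
    case 1
    then show ?thesis
      using step[of "(a', b', c' - 1)"] unfolding \<alpha> \<beta> \<gamma> by (auto split: if_splits)
  next
    case 2
    then show ?thesis
      using step[of "(a', b' - 1, z + c + 1)"] unfolding \<alpha> \<beta> \<gamma>
      by (auto split: if_splits)
  next
    case 3
    then show ?thesis
      using step[of "(a' - 1, y + b + 1, 0)"] unfolding \<alpha> \<beta> \<gamma>
      by (auto split: if_splits)
  next
    case 4
    then show ?thesis using * by (simp add: \<alpha>)
  qed
qed


section \<open>Formulas\<close>

text \<open>
  The agents \<open>1, \<dots>, h\<close> with \<open>h \<ge> 1\<close> are the elements, in increasing order, of an arbitrary
  finite linearly ordered (hence nonempty) type \<open>'i\<close>. \<open>Neg p\<close> is the negated
  proposition (written p with a bar), \<open>CKd\<close> the De Morgan dual of common knowledge \<open>CK\<close>.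
\<close>

datatype ('p, 'i) form =
    Pos 'p
  | Neg 'p
  | Or "('p, 'i) form" "('p, 'i) form"
  | And "('p, 'i) form" "('p, 'i) form"
  | Dia 'i "('p, 'i) form"
  | Box 'i "('p, 'i) form"
  | CKd "('p, 'i) form"
  | CK "('p, 'i) form"

primrec dual :: "('p, 'i) form \<Rightarrow> ('p, 'i) form" where
  "dual (Pos p) = Neg p"
| "dual (Neg p) = Pos p"
| "dual (Or A B) = And (dual A) (dual B)"
| "dual (And A B) = Or (dual A) (dual B)"
| "dual (Dia i A) = Box i (dual A)"
| "dual (Box i A) = Dia i (dual A)"
| "dual (CKd A) = CK (dual A)"
| "dual (CK A) = CKd (dual A)"

abbreviation Imp :: "('p, 'i) form \<Rightarrow> ('p, 'i) form \<Rightarrow> ('p, 'i) form" where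
  "Imp A B \<equiv> Or (dual A) B"

text \<open>
  Iterated conjunction and disjunction of a nonempty list, associated to the right;
  a singleton yields its element.
\<close>

fun Conj :: "('p, 'i) form list \<Rightarrow> ('p, 'i) form" where
  "Conj [A] = A"
| "Conj (A # B # As) = And A (Conj (B # As))"

fun Disj :: "('p, 'i) form list \<Rightarrow> ('p, 'i) form" where
  "Disj [A] = A"
| "Disj (A # B # As) = Or A (Disj (B # As))"

definition agents :: "'i::{finite,linorder} list" where
  "agents = sorted_list_of_set UNIV"

definition BoxE :: "('p, 'i::{finite,linorder}) form \<Rightarrow> ('p, 'i) form" where
  "BoxE A = Conj (map (\<lambda>i. Box i A) agents)"

definition DiaE :: "('p, 'i::{finite,linorder}) form \<Rightarrow> ('p, 'i) form" where
  "DiaE A = Disj (map (\<lambda>i. Dia i A) agents)"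

primrec rk :: "('p, 'i) form \<Rightarrow> ord" where
  "rk (Pos p) = (0, 0, 0)"
| "rk (Neg p) = (0, 0, 0)"
| "rk (Or A B) = osucc (max (rk A) (rk B))"
| "rk (And A B) = osucc (max (rk A) (rk B))"
| "rk (Dia i A) = osucc (rk A)"
| "rk (Box i A) = osucc (rk A)"
| "rk (CKd A) = omega \<oplus> rk A"
| "rk (CK A) = omega \<oplus> rk A"


section \<open>The Hilbert system\<close>

text \<open>
  Classical propositional logic is given by modus ponens and all instances of classical
  tautologies. Formulas that are not conjunctions or disjunctions are treated as atoms, except
  that the dual of a formula, being its negation, gets the opposite truth value.
\<close>

definition prop_valuation :: "(('p, 'i) form \<Rightarrow> bool) \<Rightarrow> bool" where
  "prop_valuation v \<longleftrightarrow>
     (\<forall>A. v (dual A) \<longleftrightarrow> \<not> v A) \<and>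
     (\<forall>A B. v (And A B) \<longleftrightarrow> v A \<and> v B) \<and>
     (\<forall>A B. v (Or A B) \<longleftrightarrow> v A \<or> v B)"

definition tautology :: "('p, 'i) form \<Rightarrow> bool" where
  "tautology A \<longleftrightarrow> (\<forall>v. prop_valuation v \<longrightarrow> v A)"

inductive HC :: "('p, 'i::{finite,linorder}) form \<Rightarrow> bool" where
  taut: "tautology A \<Longrightarrow> HC A"
| K: "HC (Imp (And (Box i A) (Box i (Imp A B))) (Box i B))"
| co_closure: "HC (Imp (CK A) (And (BoxE A) (BoxE (CK A))))"
| ind: "HC (Imp B (And (BoxE A) (BoxE B))) \<Longrightarrow> HC (Imp B (CK A))"
| MP: "HC A \<Longrightarrow> HC (Imp A B) \<Longrightarrow> HC B"
| nec: "HC A \<Longrightarrow> HC (Box i A)"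


section \<open>Nested sequents and the infinitary system\<close>

datatype ('p, 'i) item =
    Fm "('p, 'i) form"
  | Bx 'i "('p, 'i) item multiset"

type_synonym ('p, 'i) sequent = "('p, 'i) item multiset"

text \<open>
  A context is a sequent with exactly one occurrence of the hole, which is not inside a formula:
  \<open>CHole \<Sigma>\<close> is \<open>\<Sigma>, { }\<close> and \<open>CBx i \<Gamma> \<Sigma>\<close> is \<open>\<Sigma>, [\<Gamma>{ }]\<^sub>i\<close>.
\<close>

datatype ('p, 'i) ctx =
    CHole "('p, 'i) sequent"
  | CBx 'i "('p, 'i) ctx" "('p, 'i) sequent"

primrec fill :: "('p, 'i) ctx \<Rightarrow> ('p, 'i) sequent \<Rightarrow> ('p, 'i) sequent" where
  "fill (CHole \<Sigma>) \<Delta> = \<Sigma> + \<Delta>"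
| "fill (CBx i \<Gamma> \<Sigma>) \<Delta> = \<Sigma> + {#Bx i (fill \<Gamma> \<Delta>)#}"

text \<open>
  \<open>DC_rule \<gamma> \<P> \<Delta>\<close>: there is an instance with premises \<open>\<P>\<close> and conclusion \<open>\<Delta>\<close> of a rule of
  the system extended by cuts of rank less than \<open>\<gamma>\<close>.
\<close>

inductive DC_rule ::
  "ord \<Rightarrow> ('p, 'i::{finite,linorder}) sequent set \<Rightarrow> ('p, 'i) sequent \<Rightarrow> bool" for \<gamma> :: ord where
  ax: "DC_rule \<gamma> {} (fill \<Gamma> {#Fm (Pos p), Fm (Neg p)#})"
| conj: "DC_rule \<gamma> {fill \<Gamma> {#Fm A#}, fill \<Gamma> {#Fm B#}} (fill \<Gamma> {#Fm (And A B)#})"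
| disj: "DC_rule \<gamma> {fill \<Gamma> {#Fm A, Fm B#}} (fill \<Gamma> {#Fm (Or A B)#})"
| box: "DC_rule \<gamma> {fill \<Gamma> {#Bx i {#Fm A#}#}} (fill \<Gamma> {#Fm (Box i A)#})"
| dia: "DC_rule \<gamma> {fill \<Gamma> {#Fm (Dia i A), Bx i (\<Delta> + {#Fm A#})#}}
          (fill \<Gamma> {#Fm (Dia i A), Bx i \<Delta>#})"
| ck: "DC_rule \<gamma> {fill \<Gamma> {#Fm ((BoxE ^^ k) A)#} |k. k \<ge> 1} (fill \<Gamma> {#Fm (CK A)#})"
| ckd: "k \<ge> 1 \<Longrightarrow>
    DC_rule \<gamma> {fill \<Gamma> {#Fm (CKd A), Fm ((DiaE ^^ k) A)#}} (fill \<Gamma> {#Fm (CKd A)#})"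
| cut: "rk A < \<gamma> \<Longrightarrow> DC_rule \<gamma> {fill \<Gamma> {#Fm A#}, fill \<Gamma> {#Fm (dual A)#}} (fill \<Gamma> {#})"

text \<open>
  Derivations are well-founded, countably branching trees of sequents. The immediate subtrees form
  a set, since neither the order nor the multiplicity of premises matters for depth.
\<close>

datatype ('p, 'i) tree = Node (concl: "('p, 'i) sequent") (subtrees: "('p, 'i) tree cset")

inductive DC_proof :: "ord \<Rightarrow> ('p, 'i::{finite,linorder}) tree \<Rightarrow> bool" for \<gamma> :: ord where
  "DC_rule \<gamma> (concl ` rcset ts) \<Delta> \<Longrightarrow> (\<forall>t\<in>rcset ts. DC_proof \<gamma> t) \<Longrightarrow> DC_proof \<gamma> (Node \<Delta> ts)"

text \<open>
  \<open>has_depth t \<alpha>\<close>: \<open>\<alpha>\<close> is the least ordinal greater than the depths \<open>d s\<close> of the immediate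
  subtrees \<open>s\<close> of \<open>t\<close>. Trees of depth \<open>\<omega>\<^sup>3\<close> or more have no depth in \<open>ord\<close>; this is
  harmless as depths only occur through upper bounds in \<open>ord\<close>.
\<close>

inductive has_depth :: "('p, 'i) tree \<Rightarrow> ord \<Rightarrow> bool" where
  "(\<forall>s\<in>rcset ts. has_depth s (d s)) \<Longrightarrow>
   (\<forall>s\<in>rcset ts. d s < \<alpha>) \<Longrightarrow>
   (\<forall>\<beta>. (\<forall>s\<in>rcset ts. d s < \<beta>) \<longrightarrow> \<alpha> \<le> \<beta>) \<Longrightarrow>
   has_depth (Node \<Delta> ts) \<alpha>"

definition DC_derivable :: "ord \<Rightarrow> ord \<Rightarrow> ('p, 'i::{finite,linorder}) sequent \<Rightarrow> bool" where
  "DC_derivable \<alpha> \<gamma> \<Delta> \<longleftrightarrow> (\<exists>t \<delta>. DC_proof \<gamma> t \<and> concl t = \<Delta> \<and> has_depth t \<delta> \<and> \<delta> \<le> \<alpha>)"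

definition DC_derivable_lt :: "ord \<Rightarrow> ord \<Rightarrow> ('p, 'i::{finite,linorder}) sequent \<Rightarrow> bool" where
  "DC_derivable_lt \<alpha> \<gamma> \<Delta> \<longleftrightarrow> (\<exists>\<alpha>\<^sub>0<\<alpha>. DC_derivable \<alpha>\<^sub>0 \<gamma> \<Delta>)"

end

theory Submission
  imports Defs
begin

text \<open>
  Call a sequent uniformly derivable at level \<open>b\<close> if it has a derivation of depth below
  \<open>\<omega> \<cdot> (b + 1)\<close> inside every context. Each finitary rule, cuts included (every rank is below
  \<open>\<omega>\<^sup>2\<close>), preserves the level, and the rule for \<open>CK\<close> raises it by one; so it suffices that each
  axiom and rule of the Hilbert system only needs finitely many nested applications of that rule.
  Quantifying over all contexts makes weakening and necessitation immediate. For the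
  induction rule, the sequents consisting of \<open>dual B\<close> and \<open>\<box>\<^sup>k A\<close> are derived by induction on
  \<open>k\<close> with finitely many cuts each, hence all at the same level.
\<close>

section \<open>Depths and levels\<close>

text \<open>Choosing one derivation per premise sequent yields the subtrees. Their depths have a
  least strict upper bound in the well-order because \<alpha> already is a strict bound.\<close>

lemma DC_derivableI:
  assumes rule: "DC_rule \<gamma> P \<Delta>" and "countable P"
    and prem: "\<And>\<Theta>. \<Theta> \<in> P \<Longrightarrow> \<exists>\<beta><\<alpha>. DC_derivable \<beta> \<gamma> \<Theta>"
  shows "DC_derivable \<alpha> \<gamma> \<Delta>"
proof -
  have "\<forall>\<Theta>\<in>P. \<exists>t d. DC_proof \<gamma> t \<and> concl t = \<Theta> \<and> has_depth t d \<and> d < \<alpha>"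
    using prem unfolding DC_derivable_def by (meson le_less_trans)
  then obtain t d where td:
    "\<And>\<Theta>. \<Theta> \<in> P \<Longrightarrow> DC_proof \<gamma> (t \<Theta>) \<and> concl (t \<Theta>) = \<Theta> \<and> has_depth (t \<Theta>) (d \<Theta>) \<and> d \<Theta> < \<alpha>"
    by metis
  define ts where "ts = acset (t ` P)"
  have ts: "rcset ts = t ` P"
    unfolding ts_def using \<open>countable P\<close> by (simp add: acset_inverse)
  \<comment> \<open>The chosen subtrees are told apart by their conclusions, so \<open>concl\<close>
    turns the depths of sequents into a depth function on trees.\<close>
  define \<delta> where "\<delta> = (LEAST \<beta>. \<forall>s\<in>rcset ts. d (concl s) < \<beta>)"
  have \<alpha>: "\<forall>s\<in>rcset ts. d (concl s) < \<alpha>"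
    using td by (auto simp: ts)
  have "\<forall>s\<in>rcset ts. d (concl s) < \<delta>"
    unfolding \<delta>_def by (rule LeastI[of "\<lambda>\<beta>. \<forall>s\<in>rcset ts. d (concl s) < \<beta>", OF \<alpha>])
  then have "has_depth (Node \<Delta> ts) \<delta>"
    using td by (intro has_depth.intros[where d = "\<lambda>s. d (concl s)"])
      (auto simp: ts \<delta>_def intro: Least_le)
  moreover have "concl ` rcset ts = P"
    using td by (auto simp: ts image_image)
  then have "DC_proof \<gamma> (Node \<Delta> ts)"
    using rule td by (intro DC_proof.intros) (auto simp: ts)
  moreover have "\<delta> \<le> \<alpha>"
    unfolding \<delta>_def using \<alpha> by (rule Least_le)
  ultimately show ?thesis
    unfolding DC_derivable_def by (metis tree.sel(1))
qed

lemma DC_derivable_mono: "DC_derivable \<alpha> \<gamma> \<Delta> \<Longrightarrow> \<alpha> \<le> \<beta> \<Longrightarrow> DC_derivable \<beta> \<gamma> \<Delta>"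
  unfolding DC_derivable_def by (blast intro: order_trans)

text \<open>Only the \<open>ck\<close> rule has infinitely many premises, and these are indexed by
  natural numbers. Countability lets the subtrees form a \<open>cset\<close>.\<close>

lemma countable_premises: "DC_rule \<gamma> P \<Delta> \<Longrightarrow> countable P"
  by (induction rule: DC_rule.induct) (auto simp: setcompr_eq_image)

definition derivable_level ::
    "nat \<Rightarrow> ('p, 'i::{finite,linorder}) sequent \<Rightarrow> bool" where
  "derivable_level b \<Delta> \<longleftrightarrow> (\<exists>c. DC_derivable (0, b, c) omega_sq \<Delta>)"

lemma derivable_level_mono: "derivable_level b \<Delta> \<Longrightarrow> b \<le> b' \<Longrightarrow> derivable_level b' \<Delta>"
  unfolding derivable_level_def
  by (erule exE, rule exI, erule DC_derivable_mono) auto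

text \<open>The finite parts of finitely many depths have a maximum, so one more step stays below
  the next limit ordinal.\<close>

lemma derivable_level_finite_rule:
  assumes "DC_rule omega_sq P \<Delta>" "finite P" "\<And>\<Theta>. \<Theta> \<in> P \<Longrightarrow> derivable_level b \<Theta>"
  shows "derivable_level b \<Delta>"
proof -
  obtain c where c: "\<And>\<Theta>. \<Theta> \<in> P \<Longrightarrow> DC_derivable (0, b, c \<Theta>) omega_sq \<Theta>"
    using assms(3) unfolding derivable_level_def by metis
  \<comment> \<open>For an axiom, \<open>P\<close> is empty and \<open>Max\<close> unspecified, but
    then there is no premise to bound.\<close>
  have "\<exists>\<beta><(0, b, Suc (Max (c ` P))). DC_derivable \<beta> omega_sq \<Theta>" if "\<Theta> \<in> P" for \<Theta>
    using c[OF that] that assms(2)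
    by (intro exI[of _ "(0, b, c \<Theta>)"]) (simp add: less_Suc_eq_le)
  then have "DC_derivable (0, b, Suc (Max (c ` P))) omega_sq \<Delta>"
    by (rule DC_derivableI[OF assms(1) countable_premises[OF assms(1)]])
  then show ?thesis
    unfolding derivable_level_def by blast
qed

text \<open>Over infinitely many premises the finite parts may be unbounded, but the limit
  \<open>(0, Suc b, 0)\<close> exceeds all depths.\<close>

lemma derivable_level_rule:
  assumes "DC_rule omega_sq P \<Delta>" "\<And>\<Theta>. \<Theta> \<in> P \<Longrightarrow> derivable_level b \<Theta>"
  shows "derivable_level (Suc b) \<Delta>"
proof -
  have "\<exists>\<beta><(0, Suc b, 0). DC_derivable \<beta> omega_sq \<Theta>" if \<Theta>: "\<Theta> \<in> P" for \<Theta>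
  proof -
    obtain c where "DC_derivable (0, b, c) omega_sq \<Theta>"
      using assms(2)[OF \<Theta>] unfolding derivable_level_def by blast
    then show ?thesis by (intro exI[of _ "(0, b, c)"]) simp
  qed
  then have "DC_derivable (0, Suc b, 0) omega_sq \<Delta>"
    by (rule DC_derivableI[OF assms(1) countable_premises[OF assms(1)]])
  then show ?thesis
    unfolding derivable_level_def by blast
qed

text \<open>Neither \<open>osucc\<close> nor adding \<open>omega\<close> on the left changes a
  vanishing first component, so every formula may serve as a cut formula.\<close>

lemma rk_less_omega_sq: "rk A < omega_sq"
proof -
  have "fst (rk A) = 0"
  proof (induction A)
    case (CKd A)
    then show ?case by (cases "rk A") (simp add: omega_def)
  next
    case (CK A)
    then show ?case by (cases "rk A") (simp add: omega_def)
  next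
    case (Or A B)
    then show ?case by (cases "rk A"; cases "rk B") (auto simp: max_def)
  next
    case (And A B)
    then show ?case by (cases "rk A"; cases "rk B") (auto simp: max_def)
  next
    case (Dia i A)
    then show ?case by (cases "rk A") simp
  next
    case (Box i A)
    then show ?case by (cases "rk A") simp
  qed auto
  then show ?thesis
    by (cases "rk A") (simp add: omega_sq_def)
qed


section \<open>Uniform derivability\<close>

definition uderivable :: "nat \<Rightarrow> ('p, 'i::{finite,linorder}) sequent \<Rightarrow> bool" where
  "uderivable b \<Delta> \<longleftrightarrow> (\<forall>\<Gamma>. derivable_level b (fill \<Gamma> \<Delta>))"

text \<open>Side items are absorbed into the context. One \<open>\<Gamma>'\<close> serves all
  \<open>\<Theta>\<close>, so premises and conclusion of a rule share it.\<close>

lemma fill_plus: "\<exists>\<Gamma>'. \<forall>\<Theta>. fill \<Gamma> (\<Theta> + \<Delta>) = fill \<Gamma>' \<Theta>"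
proof (induction \<Gamma>)
  case (CHole \<Sigma>)
  show ?case by (rule exI[of _ "CHole (\<Sigma> + \<Delta>)"]) (simp add: ac_simps)
next
  case (CBx i \<Gamma> \<Sigma>)
  then obtain \<Gamma>' where "\<forall>\<Theta>. fill \<Gamma> (\<Theta> + \<Delta>) = fill \<Gamma>' \<Theta>" by blast
  then show ?case by (intro exI[of _ "CBx i \<Gamma>' \<Sigma>"]) simp
qed

text \<open>A hole inside a box is again a context, one level deeper; this is the source of
  necessitation.\<close>

lemma fill_Bx: "\<exists>\<Gamma>'. \<forall>\<Theta>. fill \<Gamma> {#Bx i \<Theta>#} = fill \<Gamma>' \<Theta>"
proof (induction \<Gamma>)
  case (CHole \<Sigma>)
  show ?case by (rule exI[of _ "CBx i (CHole {#}) \<Sigma>"]) simp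
next
  case (CBx j \<Gamma> \<Sigma>)
  then obtain \<Gamma>' where "\<forall>\<Theta>. fill \<Gamma> {#Bx i \<Theta>#} = fill \<Gamma>' \<Theta>" by blast
  then show ?case by (intro exI[of _ "CBx j \<Gamma>' \<Sigma>"]) simp
qed

lemma uderivable_mono: "uderivable b \<Delta> \<Longrightarrow> b \<le> b' \<Longrightarrow> uderivable b' \<Delta>"
  unfolding uderivable_def by (blast intro: derivable_level_mono)

lemma uderivable_weaken_plus: "uderivable b \<Delta> \<Longrightarrow> uderivable b (\<Delta> + \<Theta>)"
  unfolding uderivable_def by (metis fill_plus)

lemma uderivable_weaken: "uderivable b \<Delta> \<Longrightarrow> \<Delta> \<subseteq># \<Theta> \<Longrightarrow> uderivable b \<Theta>"
  by (metis subset_mset.add_diff_inverse uderivable_weaken_plus)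

lemma uderivable_Bx: "uderivable b \<Delta> \<Longrightarrow> uderivable b {#Bx i \<Delta>#}"
  unfolding uderivable_def by (metis fill_Bx)

text \<open>Common pattern of the finitary rules: \<open>P\<close> holds the active parts of the
  premises, and the side items \<open>\<Sigma>\<close> move into the context in which the rule is
  applied.\<close>

lemma uderivable_finite_rule:
  assumes rule: "\<And>\<Gamma>. DC_rule omega_sq (fill \<Gamma> ` P) (fill \<Gamma> \<Delta>)" and "finite P"
    and prem: "\<And>\<Theta>. \<Theta> \<in> P \<Longrightarrow> uderivable b (\<Theta> + \<Sigma>)"
  shows "uderivable b (\<Delta> + \<Sigma>)"
  unfolding uderivable_def
proof
  fix \<Gamma>
  obtain \<Gamma>' where \<Gamma>': "\<And>\<Theta>. fill \<Gamma> (\<Theta> + \<Sigma>) = fill \<Gamma>' \<Theta>"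
    using fill_plus by metis
  have "derivable_level b (fill \<Gamma>' \<Delta>)"
    using prem \<open>finite P\<close>
    by (intro derivable_level_finite_rule[OF rule]) (auto simp: uderivable_def \<Gamma>'[symmetric])
  then show "derivable_level b (fill \<Gamma> (\<Delta> + \<Sigma>))" by (simp add: \<Gamma>')
qed

section \<open>The rules of the calculus for uniform derivability\<close>

lemma uderivable_ax: "uderivable b (add_mset (Fm (Pos p)) (add_mset (Fm (Neg p)) \<Sigma>))"
  using uderivable_finite_rule[where P = "{}" and \<Delta> = "{#Fm (Pos p), Fm (Neg p)#}" and \<Sigma> = \<Sigma>]
  by (simp add: DC_rule.ax)

lemma uderivable_And:
  assumes "uderivable b (add_mset (Fm A) \<Sigma>)" "uderivable b (add_mset (Fm B) \<Sigma>)"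
  shows "uderivable b (add_mset (Fm (And A B)) \<Sigma>)"
proof -
  have "uderivable b ({#Fm (And A B)#} + \<Sigma>)"
    by (rule uderivable_finite_rule[where P = "{{#Fm A#}, {#Fm B#}}"])
      (use assms in \<open>auto simp: DC_rule.conj\<close>)
  then show ?thesis by simp
qed

lemma uderivable_Or:
  assumes "uderivable b (add_mset (Fm A) (add_mset (Fm B) \<Sigma>))"
  shows "uderivable b (add_mset (Fm (Or A B)) \<Sigma>)"
  using assms uderivable_finite_rule[where P = "{{#Fm A, Fm B#}}" and \<Delta> = "{#Fm (Or A B)#}"
      and \<Sigma> = \<Sigma> and b = b]
  by (auto simp: DC_rule.disj)

lemma uderivable_Box:
  assumes "uderivable b (add_mset (Bx i {#Fm A#}) \<Sigma>)"
  shows "uderivable b (add_mset (Fm (Box i A)) \<Sigma>)"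
  using assms uderivable_finite_rule[where P = "{{#Bx i {#Fm A#}#}}" and \<Delta> = "{#Fm (Box i A)#}"
      and \<Sigma> = \<Sigma> and b = b]
  by (auto simp: DC_rule.box)

lemma uderivable_Dia:
  assumes "uderivable b (add_mset (Bx i (add_mset (Fm A) \<Delta>)) \<Sigma>)"
  shows "uderivable b (add_mset (Fm (Dia i A)) (add_mset (Bx i \<Delta>) \<Sigma>))"
proof -
  \<comment> \<open>The rule of the calculus keeps the diamond in its premise; weakening supplies
    it.\<close>
  have "uderivable b (add_mset (Fm (Dia i A)) (add_mset (Bx i (add_mset (Fm A) \<Delta>)) \<Sigma>))"
    using assms by (rule uderivable_weaken) simp
  then show ?thesis
    using uderivable_finite_rule[where P = "{{#Fm (Dia i A), Bx i (\<Delta> + {#Fm A#})#}}"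
        and \<Delta> = "{#Fm (Dia i A), Bx i \<Delta>#}" and \<Sigma> = \<Sigma> and b = b] DC_rule.dia[of omega_sq _ i A \<Delta>]
    by auto
qed

lemma uderivable_CKd:
  assumes "k \<ge> 1" "uderivable b (add_mset (Fm ((DiaE ^^ k) A)) \<Sigma>)"
  shows "uderivable b (add_mset (Fm (CKd A)) \<Sigma>)"
proof -
  have "uderivable b (add_mset (Fm (CKd A)) (add_mset (Fm ((DiaE ^^ k) A)) \<Sigma>))"
    using assms(2) by (rule uderivable_weaken) simp
  then show ?thesis
    using uderivable_finite_rule[where P = "{{#Fm (CKd A), Fm ((DiaE ^^ k) A)#}}"
        and \<Delta> = "{#Fm (CKd A)#}" and \<Sigma> = \<Sigma> and b = b] DC_rule.ckd[OF assms(1), of omega_sq _ A]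
    by auto
qed

lemma uderivable_cut:
  assumes "uderivable b (add_mset (Fm A) \<Sigma>)" "uderivable b (add_mset (Fm (dual A)) \<Sigma>)"
  shows "uderivable b \<Sigma>"
proof -
  have "uderivable b ({#} + \<Sigma>)"
    by (rule uderivable_finite_rule[where P = "{{#Fm A#}, {#Fm (dual A)#}}"])
      (use assms in \<open>auto simp: DC_rule.cut[OF rk_less_omega_sq]\<close>)
  then show ?thesis by simp
qed

text \<open>Since the level \<open>b\<close> is common to all \<open>k\<close>, a single passage to
  the next limit bounds all premises.\<close>

lemma uderivable_CK:
  assumes "\<And>k. k \<ge> 1 \<Longrightarrow> uderivable b (add_mset (Fm ((BoxE ^^ k) A)) \<Sigma>)"
  shows "uderivable (Suc b) (add_mset (Fm (CK A)) \<Sigma>)"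
  unfolding uderivable_def
proof
  fix \<Gamma>
  obtain \<Gamma>' where \<Gamma>': "\<And>\<Theta>. fill \<Gamma> (\<Theta> + \<Sigma>) = fill \<Gamma>' \<Theta>"
    using fill_plus by metis
  have "derivable_level b (fill \<Gamma>' {#Fm ((BoxE ^^ k) A)#})" if "k \<ge> 1" for k
    using assms[OF that] by (simp add: uderivable_def \<Gamma>'[symmetric])
  then have "derivable_level (Suc b) (fill \<Gamma>' {#Fm (CK A)#})"
    by (intro derivable_level_rule[OF DC_rule.ck]) auto
  then show "derivable_level (Suc b) (fill \<Gamma> (add_mset (Fm (CK A)) \<Sigma>))"
    by (simp add: \<Gamma>'[symmetric])
qed


section \<open>Everybody knows\<close>

lemma set_agents: "set agents = UNIV"
  by (simp add: agents_def)

text \<open>This keeps \<open>Conj\<close> and \<open>Disj\<close> away from the empty list, where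
  they have no defining equation.\<close>

lemma agents_nonempty: "agents \<noteq> []"
  using set_agents by (metis UNIV_not_empty empty_set)

lemma uderivable_Conj:
  assumes "As \<noteq> []" "\<And>A. A \<in> set As \<Longrightarrow> uderivable b (add_mset (Fm A) \<Sigma>)"
  shows "uderivable b (add_mset (Fm (Conj As)) \<Sigma>)"
  using assms by (induction As rule: Conj.induct) (auto intro: uderivable_And)

lemma uderivable_Disj:
  assumes "A \<in> set As" "uderivable b (add_mset (Fm A) \<Sigma>)"
  shows "uderivable b (add_mset (Fm (Disj As)) \<Sigma>)"
  using assms
proof (induction As rule: Disj.induct)
  case (2 B C As)
  have "uderivable b (add_mset (Fm B) (add_mset (Fm (Disj (C # As))) \<Sigma>))"
  proof (cases "A = B")
    case True
    show ?thesis
      using 2(3) unfolding True by (rule uderivable_weaken) simp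
  next
    case False
    then have "uderivable b (add_mset (Fm (Disj (C # As))) \<Sigma>)"
      using 2 by auto
    then show ?thesis by (rule uderivable_weaken) simp
  qed
  then show ?case by (simp add: uderivable_Or)
qed auto

lemma uderivable_BoxE:
  assumes "\<And>i. uderivable b (add_mset (Bx i {#Fm A#}) \<Sigma>)"
  shows "uderivable b (add_mset (Fm (BoxE A)) \<Sigma>)"
  unfolding BoxE_def using assms agents_nonempty
  by (intro uderivable_Conj) (auto intro: uderivable_Box)

lemma uderivable_DiaE:
  assumes "uderivable b (add_mset (Bx i (add_mset (Fm A) \<Delta>)) \<Sigma>)"
  shows "uderivable b (add_mset (Fm (DiaE A)) (add_mset (Bx i \<Delta>) \<Sigma>))"
  unfolding DiaE_def using uderivable_Dia[OF assms]
  by (rule uderivable_Disj[rotated]) (simp add: set_agents)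

section \<open>De Morgan duality for iterated modalities\<close>

lemma dual_dual [simp]: "dual (dual A) = A"
  by (induction A) auto

lemma dual_Conj: "As \<noteq> [] \<Longrightarrow> dual (Conj As) = Disj (map dual As)"
  by (induction As rule: Conj.induct) auto

lemma dual_BoxE: "dual (BoxE A) = DiaE (dual A)"
  unfolding BoxE_def DiaE_def by (simp add: agents_nonempty dual_Conj comp_def)

lemma dual_BoxE_funpow: "dual ((BoxE ^^ k) A) = (DiaE ^^ k) (dual A)"
  by (induction k) (auto simp: dual_BoxE)


section \<open>Excluded middle\<close>

text \<open>For each agent the assumed sequent is boxed, and the diamond rule then draws the dual
  formula out of the box.\<close>

lemma uderivable_BoxE_id:
  assumes "uderivable b {#Fm A, Fm (dual A)#}"
  shows "uderivable b {#Fm (BoxE A), Fm (dual (BoxE A))#}"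
proof (rule uderivable_BoxE)
  fix i
  have "uderivable b {#Fm (DiaE (dual A)), Bx i {#Fm A#}#}"
    using uderivable_Bx[OF assms, of i]
    by (intro uderivable_DiaE) (simp add: add_mset_commute)
  then show "uderivable b {#Bx i {#Fm A#}, Fm (dual (BoxE A))#}"
    by (simp add: dual_BoxE add_mset_commute)
qed

text \<open>Each iteration uses finitary rules only, so the level does not depend on
  \<open>k\<close>; the treatment of \<open>CK\<close> relies on this.\<close>

lemma uderivable_BoxE_funpow_id:
  assumes "uderivable b {#Fm A, Fm (dual A)#}"
  shows "uderivable b {#Fm ((BoxE ^^ k) A), Fm (dual ((BoxE ^^ k) A))#}"
  using assms by (induction k) (auto intro: uderivable_BoxE_id)

lemma uderivable_id_And:
  assumes "uderivable b {#Fm A, Fm (dual A)#}" "uderivable b {#Fm B, Fm (dual B)#}"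
  shows "uderivable b {#Fm (And A B), Fm (dual (And A B))#}"
proof (rule uderivable_And)
  have "uderivable b {#Fm (dual A), Fm (dual B), Fm A#}"
    using assms(1) by (rule uderivable_weaken) (simp add: add_mset_commute)
  then have "uderivable b {#Fm (Or (dual A) (dual B)), Fm A#}"
    by (rule uderivable_Or)
  then show "uderivable b {#Fm A, Fm (dual (And A B))#}"
    by (simp add: add_mset_commute)
  have "uderivable b {#Fm (dual A), Fm (dual B), Fm B#}"
    using assms(2) by (rule uderivable_weaken) (simp add: add_mset_commute)
  then have "uderivable b {#Fm (Or (dual A) (dual B)), Fm B#}"
    by (rule uderivable_Or)
  then show "uderivable b {#Fm B, Fm (dual (And A B))#}"
    by (simp add: add_mset_commute)
qed

lemma uderivable_id_Box:
  assumes "uderivable b {#Fm A, Fm (dual A)#}"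
  shows "uderivable b {#Fm (Box i A), Fm (dual (Box i A))#}"
proof (rule uderivable_Box)
  have "uderivable b {#Fm (Dia i (dual A)), Bx i {#Fm A#}#}"
    using uderivable_Bx[OF assms, of i]
    by (intro uderivable_Dia) (simp add: add_mset_commute)
  then show "uderivable b {#Bx i {#Fm A#}, Fm (dual (Box i A))#}"
    by (simp add: add_mset_commute)
qed

lemma uderivable_id_CK:
  assumes "uderivable b {#Fm A, Fm (dual A)#}"
  shows "uderivable (Suc b) {#Fm (CK A), Fm (dual (CK A))#}"
proof (rule uderivable_CK)
  fix k :: nat assume "k \<ge> 1"
  \<comment> \<open>The premise for \<open>k\<close> is met by the \<open>CKd\<close> rule with the
    same \<open>k\<close>.\<close>
  then have "uderivable b {#Fm (CKd (dual A)), Fm ((BoxE ^^ k) A)#}"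
    using uderivable_BoxE_funpow_id[OF assms, of k]
    by (intro uderivable_CKd) (auto simp: dual_BoxE_funpow add_mset_commute)
  then show "uderivable b {#Fm ((BoxE ^^ k) A), Fm (dual (CK A))#}"
    by (simp add: add_mset_commute)
qed

text \<open>Induction on \<open>A\<close>; only the common knowledge operators raise the level, and
  binary connectives take a maximum.\<close>

lemma uderivable_id:
  fixes A :: "('p, 'i::{finite,linorder}) form"
  shows "\<exists>b. uderivable b {#Fm A, Fm (dual A)#}"
proof -
  define em where "em b A \<longleftrightarrow> uderivable b {#Fm A, Fm (dual A)#}"
    for b and A :: "('p, 'i) form"
  \<comment> \<open>The sequent is symmetric in a formula and its dual, so \<open>Or\<close>,
    \<open>Dia\<close> and \<open>CKd\<close> reduce to \<open>And\<close>, \<open>Box\<close> and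
    \<open>CK\<close>.\<close>
  have em_dual: "em b (dual A) \<longleftrightarrow> em b A" for b A
    by (simp add: em_def add_mset_commute)
  have em_And: "\<exists>b. em b (And A B)" if "\<exists>b. em b A" "\<exists>b. em b B" for A B
  proof -
    obtain b c where "em b A" "em c B" using \<open>\<exists>b. em b A\<close> \<open>\<exists>b. em b B\<close> by blast
    then have "em (max b c) A" "em (max b c) B"
      by (auto simp: em_def elim!: uderivable_mono)
    then show ?thesis unfolding em_def by (blast intro: uderivable_id_And)
  qed
  have "\<exists>b. em b A"
  proof (induction A)
    case (Pos p)
    show ?case by (auto simp: em_def intro: uderivable_ax)
  next
    case (Neg p)
    show ?case using uderivable_ax[of _ p "{#}"] by (auto simp: em_def add_mset_commute)
  next
    case (Or A B)
    then show ?case using em_And[of "dual A" "dual B"] em_dual by (metis dual.simps(3))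
  next
    case (And A B)
    then show ?case by (rule em_And)
  next
    case (Dia i A)
    then show ?case using uderivable_id_Box em_dual by (metis dual.simps(5) em_def)
  next
    case (Box i A)
    then show ?case using uderivable_id_Box by (auto simp: em_def simp del: dual.simps)
  next
    case (CKd A)
    then show ?case using uderivable_id_CK em_dual by (metis dual.simps(7) em_def)
  next
    case (CK A)
    then show ?case using uderivable_id_CK by (auto simp: em_def simp del: dual.simps)
  qed
  then show ?thesis by (simp add: em_def)
qed

lemma uderivable_id_in:
  assumes "uderivable b {#Fm A, Fm (dual A)#}" "Fm A \<in># \<Sigma>" "Fm (dual A) \<in># \<Sigma>"
  shows "uderivable b \<Sigma>"
proof -
  \<comment> \<open>As the two formulas differ, their memberships combine into an inclusion of
    multisets.\<close>
  have "A \<noteq> dual A" by (cases A) auto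
  then have "{#Fm A, Fm (dual A)#} \<subseteq># \<Sigma>"
    using assms(2,3) by (metis insert_subset_eq_iff in_diff_count item.inject(1)
        mset_subset_eq_single insert_noteq_member insert_DiffM)
  then show ?thesis using assms(1) by (rule uderivable_weaken[rotated])
qed


section \<open>Tautologies\<close>

text \<open>
  The valuation refuting a set \<open>S\<close> without complementary pairs whose members are neither
  conjunctions nor disjunctions.
\<close>

primrec refute_val :: "('p, 'i) form set \<Rightarrow> ('p, 'i) form \<Rightarrow> bool" where
  "refute_val S (Pos p) \<longleftrightarrow> Pos p \<notin> S"
| "refute_val S (Neg p) \<longleftrightarrow> Pos p \<in> S"
| "refute_val S (Or A B) \<longleftrightarrow> refute_val S A \<or> refute_val S B"
| "refute_val S (And A B) \<longleftrightarrow> refute_val S A \<and> refute_val S B"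
| "refute_val S (Dia i A) \<longleftrightarrow> Box i (dual A) \<in> S"
| "refute_val S (Box i A) \<longleftrightarrow> Box i A \<notin> S"
| "refute_val S (CKd A) \<longleftrightarrow> CK (dual A) \<in> S"
| "refute_val S (CK A) \<longleftrightarrow> CK A \<notin> S"

text \<open>The clauses for \<open>Neg\<close>, \<open>Dia\<close> and \<open>CKd\<close> consult
  the dual formula in \<open>S\<close>, so dual formulas get opposite values for any
  \<open>S\<close>.\<close>

lemma prop_valuation_refute_val: "prop_valuation (refute_val S)"
proof -
  have "refute_val S (dual A) \<longleftrightarrow> \<not> refute_val S A" for A
    by (induction A) auto
  then show ?thesis by (simp add: prop_valuation_def)
qed

lemma prop_valuation_And: "prop_valuation v \<Longrightarrow> v (And A B) \<longleftrightarrow> v A \<and> v B"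
  by (simp add: prop_valuation_def)

lemma prop_valuation_Or: "prop_valuation v \<Longrightarrow> v (Or A B) \<longleftrightarrow> v A \<or> v B"
  by (simp add: prop_valuation_def)

text \<open>Some member of \<open>S\<close> is true under \<open>refute_val S\<close>. It cannot be
  a \<open>Pos\<close>, \<open>Box\<close> or \<open>CK\<close> formula, as such members are false;
  for the other kinds, truth says that the dual lies in \<open>S\<close>.\<close>

lemma complementary_pair:
  assumes "\<forall>v. prop_valuation v \<longrightarrow> (\<exists>A\<in>S. v A)"
    and "\<And>A B. Or A B \<notin> S" "\<And>A B. And A B \<notin> S"
  shows "\<exists>A\<in>S. dual A \<in> S"
proof -
  obtain A where A: "A \<in> S" "refute_val S A"
    using assms(1) prop_valuation_refute_val by blast
  then have "dual A \<in> S"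
    using assms(2,3) by (cases A) auto
  then show ?thesis using A by blast
qed

text \<open>Backward proof search: decomposing a disjunction or conjunction preserves validity and
  decreases the total size, and an irreducible valid multiset contains a complementary pair.\<close>

lemma uderivable_valid:
  fixes M :: "('p, 'i::{finite,linorder}) form multiset"
  assumes "\<forall>v. prop_valuation v \<longrightarrow> (\<exists>A\<in>#M. v A)"
  shows "\<exists>b. uderivable b (image_mset Fm M)"
  using assms
proof (induction "sum_mset (image_mset size M)" arbitrary: M rule: less_induct)
  case less
  consider A B where "Or A B \<in># M" | A B where "And A B \<in># M"
    | "\<And>A B. Or A B \<notin># M" "\<And>A B. And A B \<notin># M"
    by blast
  then show ?case
  proof cases
    case (1 A B)
    then obtain N where N: "M = add_mset (Or A B) N" by (meson mset_add)
    have "\<forall>v. prop_valuation v \<longrightarrow> (\<exists>C\<in>#add_mset A (add_mset B N). v C)"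
      using less.prems by (auto simp: N prop_valuation_Or)
    then obtain b where "uderivable b (image_mset Fm (add_mset A (add_mset B N)))"
      using less.hyps[of "add_mset A (add_mset B N)"] by (auto simp: N)
    then show ?thesis by (auto simp: N intro: uderivable_Or)
  next
    case (2 A B)
    then obtain N where N: "M = add_mset (And A B) N" by (meson mset_add)
    have "\<forall>v. prop_valuation v \<longrightarrow> (\<exists>C\<in>#add_mset A N. v C)"
      "\<forall>v. prop_valuation v \<longrightarrow> (\<exists>C\<in>#add_mset B N. v C)"
      using less.prems by (auto simp: N prop_valuation_And)
    then obtain b c where "uderivable b (image_mset Fm (add_mset A N))"
      "uderivable c (image_mset Fm (add_mset B N))"
      using less.hyps[of "add_mset A N"] less.hyps[of "add_mset B N"] by (auto simp: N)
    then have "uderivable (max b c) (image_mset Fm (add_mset A N))"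
      "uderivable (max b c) (image_mset Fm (add_mset B N))"
      by (auto elim: uderivable_mono)
    then show ?thesis by (auto simp: N intro: uderivable_And)
  next
    case 3
    then obtain A where A: "A \<in># M" "dual A \<in># M"
      using complementary_pair[of "set_mset M"] less.prems by auto
    obtain b where "uderivable b {#Fm A, Fm (dual A)#}"
      using uderivable_id by blast
    then have "uderivable b (image_mset Fm M)"
      by (rule uderivable_id_in) (use A in auto)
    then show ?thesis ..
  qed
qed


section \<open>The Hilbert system\<close>

text \<open>Inversion of the disjunction rule by a cut: the dual of the implication is
  \<open>And A (dual B)\<close>, whose conjuncts are both covered by excluded middle.\<close>

lemma uderivable_Imp:
  assumes "uderivable b {#Fm (Imp A B)#}"
    and "uderivable b {#Fm A, Fm (dual A)#}" "uderivable b {#Fm B, Fm (dual B)#}"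
  shows "uderivable b {#Fm (dual A), Fm B#}"
proof (rule uderivable_cut[of _ "Imp A B"])
  show "uderivable b {#Fm (Imp A B), Fm (dual A), Fm B#}"
    using assms(1) by (rule uderivable_weaken) simp
  have "uderivable b {#Fm A, Fm (dual A), Fm B#}"
    by (rule uderivable_id_in[OF assms(2)]) auto
  moreover have "uderivable b {#Fm (dual B), Fm (dual A), Fm B#}"
    by (rule uderivable_id_in[OF assms(3)]) auto
  ultimately show "uderivable b {#Fm (dual (Imp A B)), Fm (dual A), Fm B#}"
    by (simp add: uderivable_And)
qed

lemma HC_K:
  fixes A B :: "('p, 'i::{finite,linorder}) form"
  shows "\<exists>b. uderivable b {#Fm (Imp (And (Box i A) (Box i (Imp A B))) (Box i B))#}"
proof -
  obtain b c where "uderivable b {#Fm A, Fm (dual A)#}" "uderivable c {#Fm B, Fm (dual B)#}"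
    using uderivable_id by metis
  then have A: "uderivable (max b c) {#Fm A, Fm (dual A)#}"
    and B: "uderivable (max b c) {#Fm B, Fm (dual B)#}"
    by (auto elim: uderivable_mono)
  \<comment> \<open>This is modus ponens inside the box. Two diamond steps then extract all but
    \<open>B\<close>, which the \<open>Box\<close> rule handles.\<close>
  have "uderivable (max b c) {#Fm (And A (dual B)), Fm (dual A), Fm B#}"
    by (intro uderivable_And; (rule uderivable_id_in[OF A] uderivable_id_in[OF B]; simp; fail))
  then have "uderivable (max b c) {#Bx i {#Fm (And A (dual B)), Fm (dual A), Fm B#}#}"
    by (rule uderivable_Bx)
  then have "uderivable (max b c) {#Fm (Dia i (And A (dual B))), Bx i {#Fm (dual A), Fm B#}#}"
    by (rule uderivable_Dia)
  then have "uderivable (max b c)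
      {#Fm (Dia i (dual A)), Bx i {#Fm B#}, Fm (Dia i (And A (dual B)))#}"
    by (intro uderivable_Dia) (simp add: add_mset_commute)
  then have "uderivable (max b c)
      {#Fm (Box i B), Fm (Dia i (dual A)), Fm (Dia i (And A (dual B)))#}"
    by (intro uderivable_Box) (simp add: add_mset_commute)
  then have "uderivable (max b c)
      {#Fm (Dia i (dual A)), Fm (Dia i (And A (dual B))), Fm (Box i B)#}"
    by (simp add: add_mset_commute)
  then have "uderivable (max b c) {#Fm (Imp (And (Box i A) (Box i (Imp A B))) (Box i B))#}"
    by (auto intro: uderivable_Or)
  then show ?thesis by blast
qed

lemma HC_co_closure:
  fixes A :: "('p, 'i::{finite,linorder}) form"
  shows "\<exists>b. uderivable b {#Fm (Imp (CK A) (And (BoxE A) (BoxE (CK A))))#}"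
proof -
  obtain b where b: "uderivable b {#Fm A, Fm (dual A)#}"
    using uderivable_id by blast
  have "uderivable b {#Fm ((DiaE ^^ 1) (dual A)), Fm (BoxE A)#}"
    using uderivable_BoxE_id[OF b] by (simp add: dual_BoxE add_mset_commute)
  then have "uderivable b {#Fm (CKd (dual A)), Fm (BoxE A)#}"
    by (rule uderivable_CKd[OF order_refl])
  then have 1: "uderivable (Suc b) {#Fm (BoxE A), Fm (CKd (dual A))#}"
    by (auto simp: add_mset_commute elim: uderivable_mono)
  have 2: "uderivable (Suc b) {#Fm (BoxE (CK A)), Fm (CKd (dual A))#}"
  proof (rule uderivable_BoxE)
    fix i
    \<comment> \<open>Here \<open>CKd\<close> is used with exponent \<open>Suc k\<close>: the
      outermost diamond enters the box and leaves \<open>k\<close> diamonds against \<open>k\<close>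
      boxes.\<close>
    have "uderivable b {#Fm (CKd (dual A)), Bx i {#Fm ((BoxE ^^ k) A)#}#}" for k
    proof (rule uderivable_CKd)
      have "uderivable b {#Bx i {#Fm ((DiaE ^^ k) (dual A)), Fm ((BoxE ^^ k) A)#}#}"
        using uderivable_Bx[OF uderivable_BoxE_funpow_id[OF b, of k]]
        by (simp add: dual_BoxE_funpow add_mset_commute)
      then show "uderivable b {#Fm ((DiaE ^^ Suc k) (dual A)), Bx i {#Fm ((BoxE ^^ k) A)#}#}"
        by (simp add: uderivable_DiaE)
    qed simp
    then have *: "derivable_level b (fill \<Gamma> {#Bx i {#Fm ((BoxE ^^ k) A)#}, Fm (CKd (dual A))#})"
      for \<Gamma> k by (simp add: uderivable_def add_mset_commute)
    show "uderivable (Suc b) {#Bx i {#Fm (CK A)#}, Fm (CKd (dual A))#}"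
      unfolding uderivable_def
    proof
      fix \<Gamma>
      \<comment> \<open>The \<open>ck\<close> rule has to act inside the box, so box and side
        formula are both absorbed into the context.\<close>
      obtain \<Gamma>' where \<Gamma>':
        "\<And>\<Theta>. fill \<Gamma> (add_mset (Bx i \<Theta>) {#Fm (CKd (dual A))#}) = fill \<Gamma>' \<Theta>"
        using fill_plus[of \<Gamma> "{#Fm (CKd (dual A))#}"] fill_Bx[where i = i]
        by (metis add_mset_add_single add_mset_commute)
      show "derivable_level (Suc b) (fill \<Gamma> {#Bx i {#Fm (CK A)#}, Fm (CKd (dual A))#})"
        unfolding \<Gamma>'
        by (rule derivable_level_rule[OF DC_rule.ck]) (use *[of \<Gamma>, unfolded \<Gamma>'] in auto)
    qed
  qed
  have "uderivable (Suc b) {#Fm (CKd (dual A)), Fm (And (BoxE A) (BoxE (CK A)))#}"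
    using uderivable_And[OF 1 2] by (simp add: add_mset_commute)
  then show ?thesis by (auto intro: uderivable_Or)
qed

lemma HC_ind:
  fixes A B :: "('p, 'i::{finite,linorder}) form"
  assumes "uderivable b {#Fm (Imp B (And (BoxE A) (BoxE B)))#}"
  shows "\<exists>b. uderivable b {#Fm (Imp B (CK A))#}"
proof -
  obtain c d where "uderivable c {#Fm A, Fm (dual A)#}" "uderivable d {#Fm B, Fm (dual B)#}"
    using uderivable_id by metis
  moreover define e where "e = max b (max c d)"
  ultimately have A: "uderivable e {#Fm A, Fm (dual A)#}"
    and B: "uderivable e {#Fm B, Fm (dual B)#}"
    and imp: "uderivable e {#Fm (Imp B (And (BoxE A) (BoxE B)))#}"
    using assms by (auto elim: uderivable_mono)
  note A' = uderivable_BoxE_id[OF A] and B' = uderivable_BoxE_id[OF B]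
  have AB: "uderivable e {#Fm (dual B), Fm (And (BoxE A) (BoxE B))#}"
    using imp B uderivable_id_And[OF A' B'] by (rule uderivable_Imp)
  \<comment> \<open>A cut with the conjunction projects the consequent to either conjunct.\<close>
  have step: "uderivable e {#Fm (dual B), Fm C#}" if "C = BoxE A \<or> C = BoxE B" for C
  proof (rule uderivable_cut[of _ "And (BoxE A) (BoxE B)"])
    show "uderivable e {#Fm (And (BoxE A) (BoxE B)), Fm (dual B), Fm C#}"
      using AB by (rule uderivable_weaken) (simp add: add_mset_commute)
    have "uderivable e {#Fm (dual (BoxE A)), Fm (dual (BoxE B)), Fm (dual B), Fm C#}"
      using that
    proof
      assume "C = BoxE A"
      then show ?thesis by (intro uderivable_id_in[OF A']) auto
    next
      assume "C = BoxE B"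
      then show ?thesis by (intro uderivable_id_in[OF B']) auto
    qed
    then show "uderivable e {#Fm (dual (And (BoxE A) (BoxE B))), Fm (dual B), Fm C#}"
      by (simp add: uderivable_Or)
  qed
  \<comment> \<open>The exponent starts at 1, as in the \<open>ck\<close> rule. Larger
    \<open>k\<close> costs more cuts, but these change only the finite part of the depth, so
    \<open>e\<close> stays fixed.\<close>
  have "uderivable e {#Fm (dual B), Fm ((BoxE ^^ Suc k) A)#}" for k
  proof (induction k)
    case 0
    show ?case using step by simp
  next
    case (Suc k)
    define C where "C = (BoxE ^^ Suc k) A"
    have "uderivable e {#Fm (dual B), Fm (BoxE C)#}"
    \<comment> \<open>One premise is the projection to \<open>BoxE B\<close>; the other is the
      induction hypothesis boxed for every agent.\<close>
    proof (rule uderivable_cut[of _ "BoxE B"])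
      show "uderivable e {#Fm (BoxE B), Fm (dual B), Fm (BoxE C)#}"
        using step[of "BoxE B"] by (auto simp: add_mset_commute elim: uderivable_weaken)
      have "uderivable e {#Fm (BoxE C), Fm (DiaE (dual B)), Fm (dual B)#}"
      proof (rule uderivable_BoxE)
        fix i
        have "uderivable e {#Bx i {#Fm (dual B), Fm C#}#}"
          using Suc by (auto simp: C_def intro: uderivable_Bx)
        then have "uderivable e {#Fm (DiaE (dual B)), Bx i {#Fm C#}#}"
          by (rule uderivable_DiaE)
        then show "uderivable e {#Bx i {#Fm C#}, Fm (DiaE (dual B)), Fm (dual B)#}"
          by (rule uderivable_weaken) (simp add: add_mset_commute)
      qed
      then show "uderivable e {#Fm (dual (BoxE B)), Fm (dual B), Fm (BoxE C)#}"
        by (simp add: dual_BoxE add_mset_commute)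
    qed
    then show ?case by (simp add: C_def)
  qed
  then have "uderivable e {#Fm ((BoxE ^^ k) A), Fm (dual B)#}" if "k \<ge> 1" for k
    using that by (cases k) (auto simp: add_mset_commute)
  then have "uderivable (Suc e) {#Fm (dual B), Fm (CK A)#}"
    using uderivable_CK[of e A "{#Fm (dual B)#}"] by (simp add: add_mset_commute)
  then show ?thesis by (auto intro: uderivable_Or)
qed

text \<open>After all levels are raised to a common maximum, \<open>A\<close> is cut against the
  inverted implication.\<close>

lemma HC_MP:
  fixes A B :: "('p, 'i::{finite,linorder}) form"
  assumes "uderivable b {#Fm A#}" "uderivable c {#Fm (Imp A B)#}"
  shows "\<exists>b. uderivable b {#Fm B#}"
proof -
  obtain d f where "uderivable d {#Fm A, Fm (dual A)#}" "uderivable f {#Fm B, Fm (dual B)#}"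
    using uderivable_id by metis
  moreover define e where "e = max (max b c) (max d f)"
  ultimately have A: "uderivable e {#Fm A, Fm (dual A)#}"
    and B: "uderivable e {#Fm B, Fm (dual B)#}"
    and "uderivable e {#Fm A#}" and imp: "uderivable e {#Fm (Imp A B)#}"
    using assms by (auto elim: uderivable_mono)
  have "uderivable e {#Fm A, Fm B#}"
    using \<open>uderivable e {#Fm A#}\<close> by (rule uderivable_weaken) simp
  then show ?thesis
    using uderivable_Imp[OF imp A B] by (blast intro: uderivable_cut)
qed

lemma HC_uderivable:
  assumes "HC A"
  shows "\<exists>b. uderivable b {#Fm A#}"
  using assms
proof induction
  case (taut A)
  then show ?case
    using uderivable_valid[of "{#A#}"] by (simp add: tautology_def)
next
  case (nec A i)
  then show ?case
    using uderivable_Bx by (blast intro: uderivable_Box)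
qed (blast intro: HC_K HC_co_closure HC_ind HC_MP)+

theorem theorem3p22:
  fixes A :: "('p, 'i::{finite,linorder}) form"
  assumes "HC A"
  shows "DC_derivable_lt omega_sq omega_sq {#Fm A#}"
proof -
  obtain b where "uderivable b {#Fm A#}"
    using HC_uderivable[OF assms] by blast
  \<comment> \<open>The empty context recovers the formula itself; any \<open>(0, b, c)\<close> lies
    below \<open>omega_sq\<close>.\<close>
  then obtain c where "DC_derivable (0, b, c) omega_sq (fill (CHole {#}) {#Fm A#})"
    unfolding uderivable_def derivable_level_def by blast
  then show ?thesis
    unfolding DC_derivable_lt_def
    by (intro exI[of _ "(0, b, c)"]) (simp add: omega_sq_def)
qed

end
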